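(* If $G$ is an AT-free graph, then $\mathrm{cub}(G)\le 3\Delta-1$, where $\Delta$ is the maximum degree of $G$ and $\mathrm{cub}(G)$ denotes the cubicity of $G$.
   Context: All graphs are simple, finite and undirected. Cubicity: a $k$-cube is a Cartesian product $R_1\times\cdots\times R_k$ where each $R_i$ is a closed interval of the form $[a_i,a_i+1]$ on the real line. The cubicity $\mathrm{cub}(G)$ is the minimum $k$ such that each vertex of $G$ can be mapped to a $k$-cube so that two distinct vertices are adjacent in $G$ if and only if their $k$-cubes have non-empty intersection. An asteroidal triple in a graph is a set of three pairwise non-adjacent vertices such that between every two of them there is a path that contains neither the third vertex nor any neighbour of the third vertex. A graph is AT-free if it contains no asteroidal triple.
   Formalization: The graph G is assumed to have at least one edge (Δ ≥ 1); for an edgeless graph, such as a single vertex, Δ = 0 and the stated bound would read cub(G) ≤ −1, which is false. *)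

theory Defs
  imports
    Complex_Main
    "HOL-Library.FuncSet"
    "Graph_Theory.Graph_Theory"
begin

(* Simple finite undirected graphs are the symmetric digraphs of the locale "graph": every
   edge {u, v} is stored as the two arcs (u, v) and (v, u).  Hence the degree of a vertex
   is its out-degree, and "u \<rightarrow>\<^bsub>G\<^esub> v" is adjacency.
   The maximum is unspecified on the null graph. *)

definition max_degree :: "('a, 'b) pre_digraph \<Rightarrow> nat" where
  "max_degree G = Max (out_degree G ` verts G)"

definition asteroidal_triple :: "('a, 'b) pre_digraph \<Rightarrow> 'a \<Rightarrow> 'a \<Rightarrow> 'a \<Rightarrow> bool" where
  "asteroidal_triple G a b c \<longleftrightarrow>
     {a, b, c} \<subseteq> verts G \<and> distinct [a, b, c] \<and>
     \<not> (a \<rightarrow>\<^bsub>G\<^esub> b) \<and> \<not> (b \<rightarrow>\<^bsub>G\<^esub> c) \<and> \<not> (a \<rightarrow>\<^bsub>G\<^esub> c) \<and>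
     (\<forall>(x, y, z) \<in> {(a, b, c), (b, c, a), (a, c, b)}.
        \<exists>p. vpath p G \<and> hd p = x \<and> last p = y \<and>
            (\<forall>w \<in> set p. w \<noteq> z \<and> \<not> (z \<rightarrow>\<^bsub>G\<^esub> w)))"

definition at_free :: "('a, 'b) pre_digraph \<Rightarrow> bool" where
  "at_free G \<longleftrightarrow> \<not> (\<exists>a b c. asteroidal_triple G a b c)"

(* Points of k-dimensional space are extensional functions on {..<k}.  The only 0-cube is a
   one-point set, so the graphs of cubicity 0 are exactly the complete graphs. *)

definition is_cube :: "nat \<Rightarrow> (nat \<Rightarrow> real) set \<Rightarrow> bool" where
  "is_cube k Q \<longleftrightarrow> (\<exists>a. Q = (\<Pi>\<^sub>E i\<in>{..<k}. {a i..a i + 1}))"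

definition cube_representation ::
    "('a, 'b) pre_digraph \<Rightarrow> nat \<Rightarrow> ('a \<Rightarrow> (nat \<Rightarrow> real) set) \<Rightarrow> bool" where
  "cube_representation G k f \<longleftrightarrow>
     (\<forall>v \<in> verts G. is_cube k (f v)) \<and>
     (\<forall>u \<in> verts G. \<forall>v \<in> verts G. u \<noteq> v \<longrightarrow> (u \<rightarrow>\<^bsub>G\<^esub> v \<longleftrightarrow> f u \<inter> f v \<noteq> {}))"

definition cubicity :: "('a, 'b) pre_digraph \<Rightarrow> nat" where
  "cubicity G = (LEAST k. \<exists>f. cube_representation G k f)"

lemma cube_Int_nonempty_iff:
  fixes a b :: "nat \<Rightarrow> real"
  shows "(\<Pi>\<^sub>E i\<in>{..<k}. {a i..a i + 1}) \<inter> (\<Pi>\<^sub>E i\<in>{..<k}. {b i..b i + 1}) \<noteq> {}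
     \<longleftrightarrow> (\<forall>i<k. \<bar>a i - b i\<bar> \<le> 1)"
proof -
  have "{a i..a i + 1} \<inter> {b i..b i + 1} \<noteq> {} \<longleftrightarrow> \<bar>a i - b i\<bar> \<le> 1" for i
    by auto
  then show ?thesis
    by (simp only: PiE_Int PiE_eq_empty_iff) auto
qed

(* The minimum in the definition of cubicity is attained. *)

lemma cube_representation_exists:
  assumes "graph G"
  shows "\<exists>k f. cube_representation G k f"
proof -
  interpret graph G by fact
  obtain n :: nat and e where e: "verts G = e ` {i. i < n}"
    using finite_verts by (auto simp: finite_conv_nat_seg_image)
  define a :: "'a \<Rightarrow> nat \<Rightarrow> real" where
    "a = (\<lambda>v i. if v = e i then 0 else if e i \<rightarrow>\<^bsub>G\<^esub> v then 1 else 2)"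
  have irrefl: "\<not> u \<rightarrow>\<^bsub>G\<^esub> u" for u
    using no_loops by (metis reachableE)
  have adj_sym: "u \<rightarrow>\<^bsub>G\<^esub> v \<longleftrightarrow> v \<rightarrow>\<^bsub>G\<^esub> u" for u v
    using sym_arcs unfolding symmetric_def by (auto dest: symD)
  have "u \<rightarrow>\<^bsub>G\<^esub> v \<longleftrightarrow> (\<forall>i<n. \<bar>a u i - a v i\<bar> \<le> 1)"
    if uv: "u \<in> verts G" "v \<in> verts G" "u \<noteq> v" for u v
  proof
    assume "u \<rightarrow>\<^bsub>G\<^esub> v"
    then show "\<forall>i<n. \<bar>a u i - a v i\<bar> \<le> 1"
      using adj_sym by (auto simp: a_def)
  next
    assume *: "\<forall>i<n. \<bar>a u i - a v i\<bar> \<le> 1"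
    obtain i where "i < n" "u = e i"
      using uv(1) unfolding e by blast
    with * have "\<bar>a u i - a v i\<bar> \<le> 1"
      by simp
    then show "u \<rightarrow>\<^bsub>G\<^esub> v"
      using \<open>u = e i\<close> \<open>u \<noteq> v\<close> by (auto simp: a_def split: if_splits)
  qed
  then have "cube_representation G n (\<lambda>v. \<Pi>\<^sub>E i\<in>{..<n}. {a v i..a v i + 1})"
    unfolding cube_representation_def is_cube_def cube_Int_nonempty_iff by blast
  then show ?thesis
    by blast
qed

end

theory Submission
  imports Defs
begin

text \<open>
  A graph whose vertices have distinct integer positions such that adjacent positions differ by at
  most \<open>b \<ge> 1\<close> has cubicity at most \<open>b + 1\<close>: one coordinate separates the positions at distance
  \<open>\<ge> b\<close>, and for each residue \<open>i\<close> modulo \<open>b\<close> one coordinate separates every position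
  \<open>j \<equiv> i\<close> from its non-neighbours among the next \<open>b - 1\<close> positions.

  For a connected AT-free graph \<open>b = 3\<Delta> - 2\<close> is achieved by sorting the vertices by their distance
  from a suitable root \<open>x\<close>.  The root is admissible: there are no vertices \<open>u, v\<close> with a
  \<open>u\<close>-\<open>x\<close> path missing the closed neighbourhood of \<open>v\<close> and a \<open>v\<close>-\<open>x\<close> path missing that of \<open>u\<close>.
  Such a root is found by maximising a component of the non-neighbours of \<open>x\<close>, and then
  repeating the choice outside that component.  Admissibility makes two consecutive levels
  dominated by the vertices of a path \<open>w0, w1, w2\<close> of which \<open>w0\<close> lies in neither level, so
  they contain at most \<open>3\<Delta> - 1\<close> vertices.
\<close>

section \<open>Graphs and connectivity inside a vertex set\<close>

locale simple_graph =
  fixes V :: "'a set" and adj :: "'a \<Rightarrow> 'a \<Rightarrow> bool" (infix "\<sim>" 50)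
  assumes finite_V: "finite V"
    and adj_V: "u \<sim> v \<Longrightarrow> u \<in> V"
    and adj_sym: "u \<sim> v \<Longrightarrow> v \<sim> u"
    and adj_irrefl: "\<not> u \<sim> u"
begin

lemma adj_V2: "u \<sim> v \<Longrightarrow> v \<in> V"
  using adj_V adj_sym by blast

lemma finite_neighbours: "finite {z. v \<sim> z}"
  by (rule finite_subset[OF _ finite_V]) (auto intro: adj_V2)

lemma card_neighbours_Un:
  assumes "\<And>v. v \<in> V \<Longrightarrow> card {w. v \<sim> w} \<le> d" "u \<in> V" "v \<in> V"
  shows "card ({z. u \<sim> z} \<union> {z. v \<sim> z}) \<le> 2 * d"
  using card_Un_le[of "{z. u \<sim> z}" "{z. v \<sim> z}"] assms(1)[OF assms(2)] assms(1)[OF assms(3)]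
  by simp

definition far :: "'a \<Rightarrow> 'a set" where
  "far v = {z \<in> V. z \<noteq> v \<and> \<not> v \<sim> z}"

lemma far_sym: "u \<in> far v \<Longrightarrow> v \<in> V \<Longrightarrow> v \<in> far u"
  using adj_sym by (auto simp: far_def)

text \<open>Walks suffice, since only connectivity inside \<open>A\<close> matters; a walk inside
  \<open>far v\<close> is one that misses the closed neighbourhood of \<open>v\<close>.\<close>

inductive joined :: "'a set \<Rightarrow> 'a \<Rightarrow> 'a \<Rightarrow> bool" for A where
  refl: "u \<in> A \<Longrightarrow> joined A u u"
| step: "u \<in> A \<Longrightarrow> u \<sim> v \<Longrightarrow> joined A v w \<Longrightarrow> joined A u w"

lemma joined_in:
  assumes "joined A u v"
  shows "u \<in> A" "v \<in> A"
  using assms by (induction rule: joined.induct) auto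

lemma joined_trans: "joined A u v \<Longrightarrow> joined A v w \<Longrightarrow> joined A u w"
  by (induction rule: joined.induct) (auto intro: joined.step)

lemma joined_snoc: "joined A u v \<Longrightarrow> v \<sim> w \<Longrightarrow> w \<in> A \<Longrightarrow> joined A u w"
  by (meson joined.intros joined_in(2) joined_trans)

lemma joined_sym: "joined A u v \<Longrightarrow> joined A v u"
  by (induction rule: joined.induct) (auto intro: joined.refl joined_snoc adj_sym)

lemma joined_mono: "joined A u v \<Longrightarrow> A \<subseteq> B \<Longrightarrow> joined B u v"
  by (induction rule: joined.induct) (auto intro: joined.intros)

text \<open>Makes the connection independent of \<open>A\<close>: it survives in every set that
  contains the component.\<close>

lemma joined_within_component:
  assumes "joined A u v"
  shows "joined {z. joined A u z} u v"
proof -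
  have "joined {z. joined A u z} w v" if "joined A w v" "joined A u w" for w
    using that
  proof (induction rule: joined.induct)
    case (step w w' v)
    then have "joined A u w'"
      using joined_snoc[of A u w w'] joined_in(1)[of A w' v] by simp
    with step show ?case
      by (auto intro: joined.step)
  qed (auto intro: joined.refl)
  then show ?thesis
    using assms joined.refl joined_in(1) by blast
qed

section \<open>Admissible vertices of AT-free graphs\<close>

definition unrelated :: "'a set \<Rightarrow> 'a \<Rightarrow> 'a \<Rightarrow> 'a \<Rightarrow> bool" where
  "unrelated R x u v \<longleftrightarrow> joined (R \<inter> far v) u x \<and> joined (R \<inter> far u) v x"

lemma unrelated_sym: "unrelated R x u v \<Longrightarrow> unrelated R x v u"
  by (simp add: unrelated_def)

end

text \<open>The ends of each walk lie in its \<open>far\<close> set, so the three vertices are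
  automatically distinct and pairwise non-adjacent.\<close>

locale at_free_graph = simple_graph +
  assumes no_triple: "a \<in> V \<Longrightarrow> b \<in> V \<Longrightarrow> c \<in> V \<Longrightarrow>
    joined (far c) a b \<Longrightarrow> joined (far a) b c \<Longrightarrow> joined (far b) a c \<Longrightarrow> False"
begin

text \<open>Two sets make the induction work: the root and the pairs come from \<open>X\<close>,
  while walks may use all of \<open>R\<close>. Passing to \<open>R'\<close> and \<open>X'\<close>
  deletes a largest component \<open>C\<close> with its boundary \<open>B\<close> and keeps as
  candidates only vertices that see all of \<open>B\<close>.\<close>

lemma ex_admissible:
  assumes "R \<subseteq> V" "X \<subseteq> R" "X \<noteq> {}"
  shows "\<exists>x\<in>X. \<forall>u\<in>X. \<forall>v\<in>X. \<not> unrelated R x u v"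
proof -
  have "finite R"
    using assms(1) finite_V finite_subset by blast
  then show ?thesis
    using assms
  proof (induction R arbitrary: X rule: finite_psubset_induct)
    case (psubset R)
    define P where "P = (SIGMA x:X. R \<inter> far x)"
    define cmp where "cmp = (\<lambda>(x, c). {z. joined (R \<inter> far x) c z})"
    show ?case
    proof (cases "P = {}")
      case True
      have "\<not> unrelated R x u v" if "x \<in> X" "u \<in> X" "v \<in> X" for x u v
      proof
        assume "unrelated R x u v"
        then have "x \<in> far v"
          using joined_in(2) unfolding unrelated_def by blast
        then have "v \<in> far x"
          using far_sym that psubset.prems by blast
        then show False
          using that psubset.prems True unfolding P_def by blast
      qed
      then show ?thesis
        using psubset.prems by blast
    next
      case False
      have "finite P"
        unfolding P_def using psubset.hyps psubset.prems by (blast intro: finite_subset)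
      with False have "Max ((card \<circ> cmp) ` P) \<in> (card \<circ> cmp) ` P"
        by (intro Max_in) auto
      then obtain x0 c0 where xc0: "(x0, c0) \<in> P"
        and m: "card (cmp (x0, c0)) = Max ((card \<circ> cmp) ` P)"
        by auto
      define C where "C = cmp (x0, c0)"
      have max: "card (cmp p) \<le> card C" if "p \<in> P" for p
        unfolding C_def m using that \<open>finite P\<close> by (intro Max_ge) auto
      have x0: "x0 \<in> X" "c0 \<in> R" "c0 \<in> far x0"
        using xc0 by (auto simp: P_def)
      define B where "B = {z \<in> R - C. \<exists>c\<in>C. c \<sim> z}"
      define R' where "R' = R - C - B"
      define X' where "X' = {y \<in> X \<inter> R'. \<forall>z\<in>B. y \<sim> z}"
      have C_sub: "C \<subseteq> R \<inter> far x0"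
        unfolding C_def cmp_def using joined_in(2) by auto
      have C_step: "z \<in> C" if "c \<in> C" "c \<sim> z" "z \<in> R \<inter> far x0" for c z
        using that joined_snoc unfolding C_def cmp_def by auto
      have C_joined: "joined C c0 c" if "c \<in> C" for c
        using that joined_within_component unfolding C_def cmp_def by auto
      have "c0 \<in> C"
        unfolding C_def cmp_def using x0 by (auto intro: joined.refl)
      \<comment> \<open>A boundary vertex missed by \<open>x0\<close> would belong to the component
        \<open>C\<close>. Hence \<open>X'\<close> is nonempty, as the induction hypothesis
        requires.\<close>
      have "x0 \<in> X'"
      proof -
        have "x0 \<notin> C"
          using C_sub by (auto simp: far_def)
        moreover have "x0 \<notin> B"
          using C_sub adj_sym by (auto simp: far_def B_def)
        moreover have "x0 \<sim> z" if z: "z \<in> B" for z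
        proof (rule ccontr)
          assume "\<not> x0 \<sim> z"
          moreover have "z \<noteq> x0" "z \<in> R" "z \<notin> C"
            using z \<open>x0 \<notin> B\<close> by (auto simp: B_def)
          moreover obtain c where "c \<in> C" "c \<sim> z"
            using z by (auto simp: B_def)
          ultimately show False
            using C_step[of c z] adj_V2 by (auto simp: far_def)
        qed
        ultimately show ?thesis
          using x0 psubset.prems by (auto simp: X'_def R'_def)
      qed
      moreover have "R' \<subset> R"
        using \<open>c0 \<in> C\<close> x0 by (auto simp: R'_def)
      moreover have "R' \<subseteq> V" "X' \<subseteq> R'"
        using psubset.prems by (auto simp: R'_def X'_def)
      ultimately obtain x where x: "x \<in> X'" and adm: "\<forall>u\<in>X'. \<forall>v\<in>X'. \<not> unrelated R' x u v"
        using psubset.IH[of R' X'] by blast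
      have xR: "x \<in> X" "x \<in> R'" "x \<in> V"
        using x \<open>R' \<subseteq> V\<close> by (auto simp: X'_def)
      have C_far: "C \<subseteq> far y" if "y \<in> R" "y \<notin> C" "y \<notin> B" for y
        using that C_sub psubset.prems adj_sym by (fastforce simp: far_def B_def)
      text \<open>By maximality of \<open>C\<close>, a vertex of \<open>X\<close> that is far from \<open>C\<close> sees the whole boundary
        \<open>B\<close>: a missed boundary vertex would enlarge its component.\<close>
      have in_X': "y \<in> X'" if y: "y \<in> X" "y \<in> far x" "y \<notin> C" for y
      proof -
        have "y \<in> R"
          using y psubset.prems by blast
        have "y \<notin> B"
          using y x by (auto simp: X'_def far_def)
        have "C \<subseteq> R \<inter> far y"
          using C_far \<open>y \<in> R\<close> \<open>y \<notin> B\<close> y C_sub by blast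
        have "C \<subseteq> cmp (y, c0)"
          using C_joined joined_mono[OF _ \<open>C \<subseteq> R \<inter> far y\<close>] by (auto simp: cmp_def)
        moreover have "finite (cmp (y, c0))"
          using psubset.hyps joined_in(2) unfolding cmp_def
          by (auto intro: finite_subset[of _ R])
        moreover have "(y, c0) \<in> P"
          using y \<open>c0 \<in> C\<close> \<open>C \<subseteq> R \<inter> far y\<close> by (auto simp: P_def)
        ultimately have eq: "C = cmp (y, c0)"
          using max card_seteq by blast
        have "y \<sim> z" if z: "z \<in> B" for z
        proof (rule ccontr)
          assume "\<not> y \<sim> z"
          moreover obtain c where "c \<in> C" "c \<sim> z" "z \<in> R" "z \<notin> C"
            using z by (auto simp: B_def)
          moreover have "z \<in> far y"
            using calculation \<open>y \<notin> B\<close> z psubset.prems by (auto simp: far_def)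
          ultimately show False
            using joined_snoc[of "R \<inter> far y" c0 c z] unfolding eq cmp_def by simp
        qed
        with y \<open>y \<in> R\<close> \<open>y \<notin> B\<close> show ?thesis
          by (auto simp: X'_def R'_def)
      qed
      \<comment> \<open>Traced back from \<open>x\<close>, the walk cannot enter \<open>B\<close>,
        all of which is adjacent to \<open>v\<close>, and \<open>C\<close> can be left only through
        \<open>B\<close>.\<close>
      have stay: "joined (R' \<inter> far v) u x" if "joined (R \<inter> far v) u x" "v \<in> X'" for u v
        using that(1) xR(2)
      proof (induction u x rule: joined.induct)
        case (refl u)
        then show ?case
          by (auto intro: joined.refl)
      next
        case (step u w x)
        then have "w \<in> R'"
          using joined_in(1) by blast
        moreover have "u \<notin> B"
          using step \<open>v \<in> X'\<close> by (auto simp: X'_def far_def)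
        moreover have "u \<notin> C"
          using \<open>w \<in> R'\<close> step(2) by (auto simp: R'_def B_def)
        ultimately have "u \<in> R' \<inter> far v"
          using step(1) by (simp add: R'_def)
        then show ?case
          using step by (blast intro: joined.step)
      qed
      \<comment> \<open>Maximality puts \<open>v\<close> into \<open>X'\<close>, so the walk from
        \<open>u\<close> stays in \<open>R'\<close>. Then \<open>u\<close> is in \<open>X'\<close>
        as well, against the choice of \<open>x\<close>.\<close>
      have one: False if "u \<in> X" "v \<in> X" "v \<notin> C" "unrelated R x u v" for u v
      proof -
        have j: "joined (R \<inter> far v) u x" "joined (R \<inter> far u) v x"
          using that by (auto simp: unrelated_def)
        then have "x \<in> far v" "x \<in> far u"
          by (auto dest: joined_in(2))
        then have "u \<in> far x" "v \<in> far x"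
          using far_sym that psubset.prems by auto
        then have "v \<in> X'"
          using in_X' that by blast
        moreover have "u \<in> X'"
          using joined_in(1)[OF stay[OF j(1) \<open>v \<in> X'\<close>]] in_X' \<open>u \<in> far x\<close> that
          by (auto simp: R'_def)
        ultimately show False
          using adm stay j unfolding unrelated_def by blast
      qed
      \<comment> \<open>Only pairs inside \<open>C\<close> remain; as \<open>C\<close> is connected
        and far from \<open>x\<close>, such a pair would form an asteroidal triple with
        \<open>x\<close>.\<close>
      have "\<not> unrelated R x u v" if uv: "u \<in> X" "v \<in> X" for u v
      proof
        assume unr: "unrelated R x u v"
        then have "u \<in> C" "v \<in> C"
          using one[of v u] one[of u v] uv unrelated_sym by auto
        then have "joined C u v"
          using joined_trans[OF joined_sym[OF C_joined] C_joined] by blast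
        moreover have "C \<subseteq> far x"
          using C_far xR by (auto simp: R'_def)
        ultimately have "joined (far x) u v"
          by (rule joined_mono)
        moreover have "joined (far v) u x" "joined (far u) v x"
          using unr by (auto simp: unrelated_def elim: joined_mono)
        ultimately show False
          using no_triple[of u v x] uv xR psubset.prems by auto
      qed
      then show ?thesis
        using xR by blast
    qed
  qed
qed

end

section \<open>Distance levels from an admissible root\<close>

locale admissible_root = simple_graph +
  fixes S :: "'a set" and x :: 'a
  assumes S_V: "S \<subseteq> V"
    and S_closed: "u \<in> S \<Longrightarrow> u \<sim> v \<Longrightarrow> v \<in> S"
    and x_S: "x \<in> S"
    and admissible: "u \<in> S \<Longrightarrow> v \<in> S \<Longrightarrow> \<not> unrelated S x u v"
begin

text \<open>The component of \<open>x\<close>; \<open>S\<close> may consist of several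
  components.\<close>

definition reach :: "'a set" where
  "reach = {v. adj\<^sup>*\<^sup>* x v}"

definition lev :: "'a \<Rightarrow> nat" where
  "lev v = (LEAST n. (adj ^^ n) x v)"

definition preds :: "'a \<Rightarrow> 'a set" where
  "preds v = {p \<in> reach. p \<sim> v \<and> Suc (lev p) = lev v}"

lemma reach_S: "reach \<subseteq> S"
proof
  fix v
  assume "v \<in> reach"
  then have "adj\<^sup>*\<^sup>* x v"
    by (simp add: reach_def)
  then show "v \<in> S"
    by (induction rule: rtranclp_induct) (auto intro: x_S S_closed)
qed

lemma x_reach: "x \<in> reach"
  by (simp add: reach_def)

lemma reach_closed: "u \<in> reach \<Longrightarrow> u \<sim> v \<Longrightarrow> v \<in> reach"
  by (auto simp: reach_def)

lemma finite_reach: "finite reach"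
  using reach_S S_V finite_V by (meson finite_subset)

lemma lev_le: "(adj ^^ n) x v \<Longrightarrow> lev v \<le> n"
  unfolding lev_def by (rule Least_le)

lemma lev_walk: "v \<in> reach \<Longrightarrow> (adj ^^ lev v) x v"
  unfolding lev_def reach_def by (auto simp: rtranclp_power intro: LeastI)

lemma lev_adj: "u \<in> reach \<Longrightarrow> u \<sim> v \<Longrightarrow> lev v \<le> Suc (lev u)"
  by (rule lev_le) (auto dest: lev_walk)

lemma lev_0: "v \<in> reach \<Longrightarrow> lev v = 0 \<Longrightarrow> v = x"
  using lev_walk[of v] by simp

lemma ex_pred:
  assumes "v \<in> reach" "lev v = Suc n"
  shows "preds v \<noteq> {}"
proof -
  obtain p where p: "(adj ^^ n) x p" "p \<sim> v"
    using lev_walk[OF assms(1)] assms(2) by (auto elim: relcomppE)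
  then have "p \<in> reach"
    by (auto simp: reach_def rtranclp_power)
  moreover have "Suc (lev p) = lev v"
    using lev_le[OF p(1)] lev_adj[OF \<open>p \<in> reach\<close> p(2)] assms(2) by simp
  ultimately show ?thesis
    using p by (auto simp: preds_def)
qed

text \<open>A shortest path from \<open>z\<close> to the root drops one level per step, so after
  \<open>z\<close> it stays at least two levels below \<open>v\<close> and meets no neighbour of
  \<open>v\<close>.\<close>

lemma joined_root:
  "z \<in> reach \<Longrightarrow> v \<in> reach \<Longrightarrow> lev z < lev v \<Longrightarrow> z \<in> far v \<Longrightarrow> joined (S \<inter> far v) z x"
proof (induction "lev z" arbitrary: z)
  case 0
  then show ?case
    using lev_0[of z] reach_S by (auto intro: joined.refl)
next
  case (Suc n)
  then obtain p where p: "p \<in> reach" "p \<sim> z" "Suc (lev p) = lev z"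
    using ex_pred[of z n] by (auto simp: preds_def)
  have "\<not> p \<sim> v"
    using lev_adj[OF p(1)] p(3) Suc.prems by fastforce
  then have "p \<in> far v"
    using p Suc.prems adj_V adj_sym by (auto simp: far_def)
  then have "joined (S \<inter> far v) p x"
    using Suc p by simp
  then show ?case
    using p Suc.prems reach_S adj_sym by (blast intro: joined.step)
qed

text \<open>Otherwise private predecessors of \<open>u\<close> and \<open>v\<close> would start paths to \<open>x\<close> showing that
  \<open>u\<close> and \<open>v\<close> are unrelated.\<close>

lemma preds_comparable:
  assumes "u \<in> reach" "v \<in> reach" "lev u = lev v" "u \<noteq> v" "\<not> u \<sim> v"
  shows "preds u \<subseteq> preds v \<or> preds v \<subseteq> preds u"
proof (rule ccontr)
  have "joined (S \<inter> far v) u x"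
    if "p \<in> preds u" "p \<notin> preds v" "u \<in> reach" "v \<in> reach" "lev u = lev v" "u \<noteq> v" "\<not> u \<sim> v" for p u v
  proof -
    have p: "p \<in> reach" "p \<sim> u" "Suc (lev p) = lev v" "\<not> p \<sim> v"
      using that by (auto simp: preds_def)
    then have "p \<in> far v"
      using adj_V adj_sym by (auto simp: far_def)
    moreover have "u \<in> S \<inter> far v"
      using that reach_S S_V adj_sym by (auto simp: far_def)
    ultimately show ?thesis
      using joined_root[of p v] p that adj_sym by (auto intro: joined.step)
  qed
  moreover assume "\<not> ?thesis"
  ultimately have "unrelated S x u v"
    unfolding unrelated_def using assms adj_sym by (metis subsetI)
  then show False
    using admissible assms reach_S by blast
qed

text \<open>By comparability, a \<open>preds\<close> set of least cardinality is contained in that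
  of every non-neighbour of \<open>w\<close>.\<close>

lemma ex_minimal_preds:
  assumes "T \<subseteq> reach" "T \<noteq> {}" "\<And>v. v \<in> T \<Longrightarrow> lev v = i"
  shows "\<exists>w\<in>T. \<forall>u\<in>T. u = w \<or> u \<sim> w \<or> preds w \<subseteq> preds u"
proof -
  have "finite T"
    using assms(1) finite_reach finite_subset by blast
  then obtain w where w: "w \<in> T" "\<forall>u\<in>T. card (preds w) \<le> card (preds u)"
    using ex_min_if_finite[of "(card \<circ> preds) ` T"] assms(2)
    by (auto simp: not_less)
  have "preds w \<subseteq> preds u" if "u \<in> T" "u \<noteq> w" "\<not> u \<sim> w" for u
  proof -
    have "finite (preds w)"
      using finite_reach by (auto simp: preds_def)
    then show ?thesis
      using preds_comparable[of u w] w that assms card_seteq[of "preds w" "preds u"] by blast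
  qed
  with w show ?thesis
    by blast
qed

text \<open>If \<open>u\<close> were far from all three vertices of the shortest path \<open>w2, w1, w0\<close>, then
  \<open>u\<close> and \<open>w2\<close> would be unrelated with respect to the admissible vertex \<open>x\<close>.\<close>

lemma dominated_by_path:
  assumes "u \<in> reach" "w2 \<in> reach" "w1 \<in> preds w2" "w0 \<in> preds w1" "lev u = lev w1"
    and "\<not> u \<sim> w2" "u \<noteq> w1" "\<not> u \<sim> w1"
  shows "u \<sim> w0"
proof (rule ccontr)
  assume "\<not> u \<sim> w0"
  have w: "w1 \<in> reach" "w0 \<in> reach" "w0 \<sim> w1" "w1 \<sim> w2" "Suc (lev w1) = lev w2" "Suc (lev w0) = lev w1"
    using assms by (auto simp: preds_def)
  then have "u \<noteq> w2" "u \<noteq> w0"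
    using assms by auto
  then have far: "w0 \<in> far u" "w1 \<in> far u" "w2 \<in> far u" "u \<in> far w2"
    using assms \<open>\<not> u \<sim> w0\<close> w reach_S S_V adj_sym by (auto simp: far_def)
  then have "joined (S \<inter> far w2) u x"
    using joined_root[of u w2] assms w by auto
  moreover have "joined (S \<inter> far u) w0 x"
    using joined_root[of w0 u] far assms w by auto
  then have "joined (S \<inter> far u) w2 x"
    using far w assms reach_S adj_sym by (blast intro: joined.step)
  ultimately show False
    using admissible[of u w2] assms reach_S by (auto simp: unrelated_def)
qed

text \<open>In the main case \<open>w2\<close> and \<open>w1\<close> dominate level
  \<open>Suc i\<close>, and \<open>w1\<close> and \<open>w0\<close> dominate level \<open>i\<close>.
  The three neighbourhoods give \<open>3 * d\<close>, less one for \<open>w0\<close>, a neighbour of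
  \<open>w1\<close> that lies one level too low.\<close>

lemma card_two_levels:
  assumes deg: "\<And>v. v \<in> V \<Longrightarrow> card {w. v \<sim> w} \<le> d" and "d > 0"
  shows "card {v \<in> reach. lev v = i \<or> lev v = Suc i} \<le> 3 * d - 1"
proof -
  define L where "L n = {v \<in> reach. lev v = n}" for n
  define N where "N v = {z. v \<sim> z}" for v
  have fin: "finite (N v)" for v
    unfolding N_def by (rule finite_neighbours)
  have KV: "v \<in> V" if "v \<in> reach" for v
    using that reach_S S_V by blast
  have eq: "{v \<in> reach. lev v = i \<or> lev v = Suc i} = L i \<union> L (Suc i)"
    by (auto simp: L_def)
  consider "i = 0" | "i > 0" "L (Suc i) = {}" "L i = {}" | "i > 0" "L (Suc i) = {}" "L i \<noteq> {}"
    | "i > 0" "L (Suc i) \<noteq> {}"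
    by auto
  then have "card (L i \<union> L (Suc i)) \<le> 3 * d - 1"
  proof cases
    \<comment> \<open>Below level 0 there is no \<open>w0\<close>. The direct count gives
      \<open>Suc d\<close>, which is at most \<open>3 * d - 1\<close> because
      \<open>d > 0\<close>.\<close>
    case 1
    have "L 0 \<union> L 1 \<subseteq> insert x (N x)"
    proof
      fix v assume v: "v \<in> L 0 \<union> L 1"
      show "v \<in> insert x (N x)"
      proof (cases "lev v = 0")
        case False
        then have "lev v = Suc 0" "v \<in> reach"
          using v by (auto simp: L_def)
        then obtain p where "p \<in> preds v" using ex_pred by blast
        then show ?thesis
          using \<open>lev v = Suc 0\<close> lev_0 by (auto simp: preds_def N_def)
      qed (use v lev_0 in \<open>auto simp: L_def\<close>)
    qed
    then have "card (L 0 \<union> L 1) \<le> card (insert x (N x))"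
      using fin by (intro card_mono) auto
    also have "\<dots> \<le> Suc d"
      using deg[of x] KV[OF x_reach] fin[of x] card_insert_le_m1[of "Suc d" "N x" x] by (simp add: N_def)
    finally show ?thesis
      using 1 \<open>d > 0\<close> by simp
  next
    case 2
    then show ?thesis by simp
  next
    \<comment> \<open>Here \<open>i\<close> is the last level, and two neighbourhoods
      suffice.\<close>
    case 3
    then obtain w1 where w1: "w1 \<in> L i" "\<forall>u\<in>L i. u = w1 \<or> u \<sim> w1 \<or> preds w1 \<subseteq> preds u"
      using ex_minimal_preds[of "L i" i] unfolding L_def by blast
    obtain w0 where w0: "w0 \<in> preds w1"
      using ex_pred[of w1 "i - 1"] w1 3 by (auto simp: L_def)
    have "L i \<subseteq> N w0 \<union> N w1"
    proof
      fix u
      assume "u \<in> L i"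
      then have "u = w1 \<or> u \<sim> w1 \<or> w0 \<in> preds u"
        using w1(2) w0 by blast
      then show "u \<in> N w0 \<union> N w1"
        using w0 adj_sym by (auto simp: preds_def N_def)
    qed
    then have "card (L i) \<le> card (N w0 \<union> N w1)"
      using fin by (intro card_mono) auto
    also have "\<dots> \<le> 2 * d"
      unfolding N_def using w0 w1 KV deg
      by (intro card_neighbours_Un) (auto simp: preds_def L_def)
    finally show ?thesis
      using 3 \<open>d > 0\<close> by simp
  next
    case 4
    then obtain w2 where w2: "w2 \<in> L (Suc i)"
      "\<forall>u\<in>L (Suc i). u = w2 \<or> u \<sim> w2 \<or> preds w2 \<subseteq> preds u"
      using ex_minimal_preds[of "L (Suc i)" "Suc i"] unfolding L_def by blast
    have "preds w2 \<noteq> {}" "preds w2 \<subseteq> L i"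
      using ex_pred[of w2 i] w2 by (auto simp: L_def preds_def)
    then obtain w1 where w1: "w1 \<in> preds w2"
      "\<forall>u\<in>preds w2. u = w1 \<or> u \<sim> w1 \<or> preds w1 \<subseteq> preds u"
      using ex_minimal_preds[of "preds w2" i] unfolding L_def by blast
    have "w1 \<in> L i"
      using w1 \<open>preds w2 \<subseteq> L i\<close> by blast
    then obtain w0 where w0: "w0 \<in> preds w1"
      using ex_pred[of w1 "i - 1"] 4 by (auto simp: L_def)
    have w: "w1 \<in> reach" "w0 \<in> reach" "w2 \<in> reach" "w0 \<sim> w1" "w1 \<sim> w2" "lev w1 = i" "Suc (lev w0) = i"
      using w0 w1 w2 \<open>w1 \<in> L i\<close> by (auto simp: preds_def L_def)
    \<comment> \<open>Predecessors of \<open>w2\<close> are covered by the minimality of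
      \<open>w1\<close> among them, the rest of level \<open>i\<close> by admissibility of the
      root.\<close>
    have "u = w1 \<or> u \<sim> w1 \<or> u \<sim> w0" if "u \<in> L i" for u
    proof (cases "u \<in> preds w2")
      case True
      then show ?thesis
        using w1(2) w0 adj_sym by (auto simp: preds_def)
    next
      case False
      then have "\<not> u \<sim> w2"
        using that w2 by (auto simp: preds_def L_def)
      then show ?thesis
        using dominated_by_path[of u w2 w1 w0] that w w0 w1 by (auto simp: L_def)
    qed
    moreover have "u = w2 \<or> u \<sim> w2 \<or> u \<sim> w1" if "u \<in> L (Suc i)" for u
    proof -
      have "u = w2 \<or> u \<sim> w2 \<or> w1 \<in> preds u"
        using that w1(1) w2(2) by blast
      then show ?thesis
        using adj_sym by (auto simp: preds_def)
    qed
    ultimately have "L i \<union> L (Suc i) \<subseteq> (N w0 \<union> N w2) \<union> (N w1 - {w0})"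
    proof -
      assume *: "\<And>u. u \<in> L i \<Longrightarrow> u = w1 \<or> u \<sim> w1 \<or> u \<sim> w0"
        "\<And>u. u \<in> L (Suc i) \<Longrightarrow> u = w2 \<or> u \<sim> w2 \<or> u \<sim> w1"
      have "w0 \<notin> L i \<union> L (Suc i)"
        using w by (auto simp: L_def)
      moreover have "z \<in> N w0 \<union> N w2 \<union> N w1" if "z \<in> L i \<union> L (Suc i)" for z
        using that *[of z] w adj_sym by (auto simp: N_def)
      ultimately show ?thesis
        by blast
    qed
    then have "card (L i \<union> L (Suc i)) \<le> card ((N w0 \<union> N w2) \<union> (N w1 - {w0}))"
      using fin by (intro card_mono) auto
    also have "\<dots> \<le> card (N w0 \<union> N w2) + card (N w1 - {w0})"
      by (rule card_Un_le)
    also have "card (N w0 \<union> N w2) \<le> 2 * d"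
      unfolding N_def using w KV deg by (intro card_neighbours_Un) auto
    also have "card (N w1 - {w0}) = card (N w1) - 1"
      using w adj_sym fin by (auto simp: N_def)
    also have "card (N w1) - 1 \<le> d - 1"
      using deg[of w1] KV w by (auto simp: N_def intro: diff_le_mono)
    finally show ?thesis
      using \<open>d > 0\<close> by simp
  qed
  then show ?thesis
    unfolding eq .
qed

text \<open>Vertices are sorted by level, with ties broken by \<open>e\<close>, and numbered by how
  many precede them. If \<open>u\<close> precedes its neighbour \<open>v\<close>, the numbers differ
  by at most the size of the two levels from \<open>lev u\<close> on without
  \<open>v\<close>.\<close>

lemma component_layout:
  assumes deg: "\<And>v. v \<in> V \<Longrightarrow> card {w. v \<sim> w} \<le> d" and "d > 0"
  shows "\<exists>f :: 'a \<Rightarrow> nat. inj_on f reach \<and> (\<forall>u\<in>reach. \<forall>v\<in>reach. u \<sim> v \<longrightarrow> f v \<le> f u + (3 * d - 2))"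
proof -
  obtain e :: "'a \<Rightarrow> nat" where e: "inj_on e reach"
    using finite_imp_inj_to_nat_seg[OF finite_reach] by blast
  define below where "below v = {z \<in> reach. lev z < lev v \<or> lev z = lev v \<and> e z < e v}" for v
  have fin: "finite (below v)" for v
    using finite_reach by (auto simp: below_def)
  have less: "card (below u) < card (below v)" if "u \<in> below v" for u v
    using that by (intro psubset_card_mono fin) (auto simp: below_def)
  have cases: "u \<in> below v \<or> v \<in> below u \<or> u = v" if "u \<in> reach" "v \<in> reach" for u v
    using that inj_onD[OF e, of u v] linorder_less_linear[of "e u" "e v"]
    by (auto simp: below_def)
  have "inj_on (card \<circ> below) reach"
    using less cases by (fastforce intro: inj_onI)
  moreover have "card (below v) \<le> card (below u) + (3 * d - 2)"
    if uv: "u \<in> reach" "v \<in> reach" "u \<sim> v" for u v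
  proof (cases "u \<in> below v")
    case True
    define M where "M = {z \<in> reach. lev z = lev u \<or> lev z = Suc (lev u)}"
    have "finite M"
      using finite_reach by (auto simp: M_def)
    have "lev v \<le> Suc (lev u)"
      using uv lev_adj by blast
    then have "below v \<subseteq> below u \<union> (M - {v})"
      by (auto simp: below_def M_def)
    then have "card (below v) \<le> card (below u \<union> (M - {v}))"
      using fin \<open>finite M\<close> by (intro card_mono) auto
    also have "\<dots> \<le> card (below u) + card (M - {v})"
      by (rule card_Un_le)
    also have "v \<in> M"
      using True uv \<open>lev v \<le> Suc (lev u)\<close> by (auto simp: below_def M_def)
    then have "card (M - {v}) = card M - 1"
      by simp
    also have "card M - 1 \<le> 3 * d - 1 - 1"
      unfolding M_def by (intro diff_le_mono card_two_levels deg \<open>d > 0\<close>)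
    finally show ?thesis by simp
  next
    case False
    then show ?thesis
      using cases[OF uv(1,2)] less[of v u] uv adj_irrefl by auto
  qed
  ultimately show ?thesis
    by (intro exI[of _ "card \<circ> below"]) simp
qed

end

section \<open>Layout of all components\<close>

context at_free_graph
begin

text \<open>Induction over unions of components: the component of an admissible root is laid out
  first, and the rest is shifted behind it. No edge joins the two parts.\<close>

lemma ex_layout:
  assumes deg: "\<And>v. v \<in> V \<Longrightarrow> card {w. v \<sim> w} \<le> d" and "d > 0"
    and "S \<subseteq> V" "\<And>u v. u \<in> S \<Longrightarrow> u \<sim> v \<Longrightarrow> v \<in> S"
  shows "\<exists>f :: 'a \<Rightarrow> nat. inj_on f S \<and> (\<forall>u\<in>S. \<forall>v\<in>S. u \<sim> v \<longrightarrow> f v \<le> f u + (3 * d - 2))"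
proof -
  have "finite S"
    using assms(3) finite_V finite_subset by blast
  then show ?thesis
    using assms(3,4)
  proof (induction S rule: finite_psubset_induct)
    case (psubset S)
    show ?case
    proof (cases "S = {}")
      case False
      then obtain x where "x \<in> S" and "\<forall>u\<in>S. \<forall>v\<in>S. \<not> unrelated S x u v"
        using ex_admissible[of S S] psubset.prems by blast
      then interpret admissible_root V adj S x
        using psubset.prems by unfold_locales auto
      obtain f :: "'a \<Rightarrow> nat" where f: "inj_on f reach"
        "\<And>u v. u \<in> reach \<Longrightarrow> v \<in> reach \<Longrightarrow> u \<sim> v \<Longrightarrow> f v \<le> f u + (3 * d - 2)"
        using component_layout[OF deg \<open>d > 0\<close>] by blast
      have closed: "v \<in> S - reach" if "u \<in> S - reach" "u \<sim> v" for u v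
        using that reach_closed adj_sym S_closed by blast
      moreover have "S - reach \<subset> S"
        using x_reach x_S by blast
      moreover have "S - reach \<subseteq> V"
        using S_V by blast
      ultimately have "\<exists>g :: 'a \<Rightarrow> nat. inj_on g (S - reach) \<and>
          (\<forall>u\<in>S - reach. \<forall>v\<in>S - reach. u \<sim> v \<longrightarrow> g v \<le> g u + (3 * d - 2))"
        by (intro psubset.IH)
      then obtain g :: "'a \<Rightarrow> nat" where g: "inj_on g (S - reach)"
        "\<And>u v. u \<in> S - reach \<Longrightarrow> v \<in> S - reach \<Longrightarrow> u \<sim> v \<Longrightarrow> g v \<le> g u + (3 * d - 2)"
        by blast
      define h where "h v = (if v \<in> reach then f v else Suc (Max (f ` reach)) + g v)" for v
      have le: "f v \<le> Max (f ` reach)" if "v \<in> reach" for v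
        using that finite_reach by simp
      have "inj_on h S"
      proof (rule inj_onI)
        fix u v
        assume "u \<in> S" "v \<in> S" "h u = h v"
        then show "u = v"
          using f(1) g(1) le[of u] le[of v] unfolding h_def inj_on_def
          by (auto split: if_splits)
      qed
      moreover have "h v \<le> h u + (3 * d - 2)" if "u \<in> S" "v \<in> S" "u \<sim> v" for u v
      proof (cases "u \<in> reach")
        case True
        with that reach_closed f(2)[of u v] show ?thesis
          by (auto simp: h_def)
      next
        case False
        with that closed[of u v] g(2)[of u v] show ?thesis
          by (auto simp: h_def)
      qed
      ultimately show ?thesis
        by blast
    qed simp
  qed
qed

end

section \<open>Coordinates from a layout of bounded bandwidth\<close>

lemma div_mod_add_le:
  fixes m t b :: nat
  assumes "0 < t" "t \<le> b"
  shows "(m + t) div b = m div b \<and> (m + t) mod b = m mod b + t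
    \<or> (m + t) div b = Suc (m div b) \<and> (m + t) mod b + b = m mod b + t"
proof -
  define q r where "q = m div b" and "r = m mod b"
  have m: "m = r + b * q" and r: "r < b"
    using assms by (auto simp: q_def r_def)
  show ?thesis
  proof (cases "r + t < b")
    case True
    then have "(m + t) div b = q" "(m + t) mod b = r + t"
      using div_mult_self2[of b "r + t" q] mod_mult_self2[of "r + t" b q]
      by (simp_all add: m ac_simps)
    then show ?thesis
      by (simp add: q_def r_def)
  next
    case False
    then obtain s where s: "r + t = s + b" "s < b"
      using r assms by (metis add.commute add_less_le_mono le_add_diff_inverse2 nat_add_left_cancel_less not_less)
    then have "m + t = s + b * Suc q"
      by (simp add: m)
    then have "(m + t) div b = Suc q" "(m + t) mod b = s"
      using s(2) div_mult_self2[of b s "Suc q"] mod_mult_self2[of s b "Suc q"] by simp_all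
    then show ?thesis
      using s by (simp add: q_def r_def)
  qed
qed

text \<open>The spacing \<open>1/b\<close> puts positions at distance exactly \<open>b\<close> at distance exactly \<open>1\<close>.  A
  perturbation of total size below \<open>1/b\<close>, which grows by one unit from \<open>l\<close> to \<open>l + b\<close> exactly if
  these are not adjacent, pushes the non-adjacent ones apart.\<close>

definition slack_count :: "(nat \<Rightarrow> nat \<Rightarrow> bool) \<Rightarrow> nat \<Rightarrow> nat \<Rightarrow> nat" where
  "slack_count A b j = card {m. m < j div b \<and> \<not> A (j mod b + m * b) (j mod b + m * b + b)}"

lemma slack_count_le: "slack_count A b j \<le> j"
proof -
  have "slack_count A b j \<le> card {..<j div b}"
    unfolding slack_count_def by (intro card_mono) auto
  also have "\<dots> \<le> j"
    by simp
  finally show ?thesis .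
qed

lemma slack_count_add:
  assumes "b > 0"
  shows "slack_count A b (j + b) = slack_count A b j + (if A j (j + b) then 0 else 1)"
proof -
  define P where "P m \<longleftrightarrow> \<not> A (j mod b + m * b) (j mod b + m * b + b)" for m
  have "{m. m < Suc q \<and> P m} = (if P q then insert q {m. m < q \<and> P m} else {m. m < q \<and> P m})" for q
    by (auto simp: less_Suc_eq)
  then have "card {m. m < Suc q \<and> P m} = card {m. m < q \<and> P m} + (if P q then 1 else 0)" for q
    by simp
  moreover have "P (j div b) \<longleftrightarrow> \<not> A j (j + b)"
    unfolding P_def by (simp add: mod_div_mult_eq)
  ultimately show ?thesis
    using assms by (simp add: slack_count_def P_def)
qed

text \<open>For \<open>j < N\<close> and \<open>b > 0\<close> the second term is below
  \<open>1 / (2 * b)\<close>, because \<open>slack_count A b j \<le> j\<close>.\<close>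

definition far_coord :: "(nat \<Rightarrow> nat \<Rightarrow> bool) \<Rightarrow> nat \<Rightarrow> nat \<Rightarrow> nat \<Rightarrow> real" where
  "far_coord A b N j = j / b + slack_count A b j / (2 * b * N)"

text \<open>Scaled by \<open>b\<close>, both perturbations lie in \<open>[0, 1)\<close>, so they are
  decisive only for positions exactly \<open>b\<close> apart.\<close>

lemma far_coord_iff:
  assumes "b > 0" "j < k" "j < N" "k < N"
  shows "\<bar>far_coord A b N j - far_coord A b N k\<bar> \<le> 1 \<longleftrightarrow> k < j + b \<or> k = j + b \<and> A j k"
proof -
  define p where "p j = slack_count A b j / (2 * b * N)" for j
  have p0: "0 \<le> p j" for j
    by (simp add: p_def)
  have p1: "p j * b < 1" if "j < N" for j
    using that assms(1) slack_count_le[of A b j] by (simp add: p_def field_simps)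
  have diff: "(far_coord A b N k - far_coord A b N j) * b = real k - real j + p k * b - p j * b"
    using assms(1) by (simp add: far_coord_def p_def field_simps)
  have iff: "\<bar>far_coord A b N j - far_coord A b N k\<bar> \<le> 1
      \<longleftrightarrow> \<bar>real k - real j + p k * b - p j * b\<bar> \<le> b"
  proof -
    have "\<bar>real k - real j + p k * b - p j * b\<bar> = \<bar>far_coord A b N j - far_coord A b N k\<bar> * b"
      unfolding diff[symmetric] by (simp add: abs_mult abs_minus_commute)
    then show ?thesis
      using assms(1) by simp
  qed
  have pb: "0 \<le> p j * b" "0 \<le> p k * b" "p j * b < 1" "p k * b < 1"
    using p0 p1 assms by simp_all
  consider "k < j + b" | "k = j + b" | "k > j + b"
    by linarith
  then show ?thesis
  proof cases
    case 1
    then have "real k + 1 \<le> real j + real b" "real j + 1 \<le> real k"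
      using assms by linarith+
    then show ?thesis
      using 1 pb unfolding iff by linarith
  next
    case 2
    have "p k * b - p j * b = (if A j k then 0 else 1 / (2 * N))"
      using slack_count_add[OF assms(1), of A j] assms(1)
      by (simp add: p_def 2 add_divide_distrib distrib_right)
    then have "0 \<le> p k * b - p j * b" and A: "A j k \<longleftrightarrow> p k * b - p j * b \<le> 0"
      using assms by simp_all
    moreover have "real k - real j = b"
      by (simp add: 2)
    ultimately have "\<bar>real k - real j + p k * b - p j * b\<bar> \<le> b \<longleftrightarrow> A j k"
      unfolding A by linarith
    then show ?thesis
      using 2 unfolding iff by simp
  next
    case 3
    then have "real k \<ge> real j + real b + 1"
      by linarith
    then show ?thesis
      using 3 pb unfolding iff by linarith
  qed
qed

text \<open>The positions \<open>w \<equiv> i\<close> modulo \<open>b\<close> cut the line into blocks.  Moving from one block to the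
  next shifts by only \<open>1/2\<close>, so that within a block the neighbours of \<open>w\<close> can be placed at
  \<open>w + 1\<close> and its non-neighbours at \<open>w + 3/2\<close> without separating anything else in this or the
  next block.  If \<open>j\<close> precedes the first \<open>w\<close>, then \<open>j - r\<close> is truncated to \<open>0\<close>; either value of
  the inner conditional is fine for such \<open>j\<close>.\<close>

definition near_coord :: "(nat \<Rightarrow> nat \<Rightarrow> bool) \<Rightarrow> nat \<Rightarrow> nat \<Rightarrow> nat \<Rightarrow> real" where
  "near_coord A b i j = real ((j + (b - i)) div b) / 2 +
     (let r = (j + (b - i)) mod b in if r = 0 then 0 else if A (j - r) j then 1 else 3 / 2)"

lemma near_coord_adj:
  assumes "A j k" "j < k" "k \<le> j + b"
  shows "\<bar>near_coord A b i j - near_coord A b i k\<bar> \<le> 1"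
proof -
  define m where "m = j + (b - i)"
  define t where "t = k - j"
  have k: "k + (b - i) = m + t" and t: "0 < t" "t \<le> b" "k - t = j"
    using assms by (auto simp: m_def t_def)
  show ?thesis
    using div_mod_add_le[OF t(1,2), of m]
  proof
    assume "(m + t) div b = m div b \<and> (m + t) mod b = m mod b + t"
    then show ?thesis
      using t assms(1) unfolding near_coord_def k m_def[symmetric] Let_def
      by auto
  next
    assume *: "(m + t) div b = Suc (m div b) \<and> (m + t) mod b + b = m mod b + t"
    \<comment> \<open>From the start of a block, the next block is reached only with
      \<open>t = b\<close>, hence at its start; any other landing point would be too far
      away.\<close>
    then have "m mod b = 0 \<Longrightarrow> (m + t) mod b = 0"
      using t by simp
    with * show ?thesis
      unfolding near_coord_def k m_def[symmetric] Let_def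
      by (auto simp: add_divide_distrib)
  qed
qed

text \<open>In the coordinate of its own residue \<open>j\<close> starts a block, and
  \<open>k\<close> lies in the same block at offset \<open>3 / 2\<close>.\<close>

lemma near_coord_nonadj:
  assumes "\<not> A j k" "j < k" "k < j + b"
  shows "\<bar>near_coord A b (j mod b) j - near_coord A b (j mod b) k\<bar> > 1"
proof -
  define m where "m = j + (b - j mod b)"
  define t where "t = k - j"
  have k: "k + (b - j mod b) = m + t" and t: "0 < t" "t < b" "k - t = j"
    unfolding m_def t_def using assms by linarith+
  have "j mod b < b"
    using assms by simp
  then have "m = j div b * b + b"
    using div_mult_mod_eq[of j b] unfolding m_def by linarith
  then have m: "m mod b = 0"
    by simp
  have "(m + t) div b = m div b \<and> (m + t) mod b = t"
    using div_mod_add_le[of t b m] t m by auto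
  then show ?thesis
    using t m assms(1) unfolding near_coord_def k m_def[symmetric] Let_def by auto
qed

lemma ex_coordinates:
  fixes A :: "nat \<Rightarrow> nat \<Rightarrow> bool"
  assumes "b > 0" and sym: "\<And>j k. A j k \<Longrightarrow> A k j"
    and bandwidth: "\<And>j k. A j k \<Longrightarrow> k \<le> j + b"
  shows "\<exists>a :: nat \<Rightarrow> nat \<Rightarrow> real. \<forall>j<N. \<forall>k<N. j \<noteq> k \<longrightarrow>
    (A j k \<longleftrightarrow> (\<forall>i<Suc b. \<bar>a j i - a k i\<bar> \<le> 1))"
proof -
  define a where "a j i = (if i < b then near_coord A b i j else far_coord A b N j)" for j i
  have "A j k \<longleftrightarrow> (\<forall>i<Suc b. \<bar>a j i - a k i\<bar> \<le> 1)" if "j < k" "k < N" for j k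
  proof
    assume "A j k"
    then show "\<forall>i<Suc b. \<bar>a j i - a k i\<bar> \<le> 1"
      using that bandwidth[of j k] near_coord_adj[of A j k b] far_coord_iff[OF assms(1), of j k N A]
      by (auto simp: a_def)
  next
    assume *: "\<forall>i<Suc b. \<bar>a j i - a k i\<bar> \<le> 1"
    \<comment> \<open>The far coordinate leaves only distances below \<open>b\<close> open; the near
      coordinate for the residue of \<open>j\<close> settles those.\<close>
    then have "k < j + b \<or> k = j + b \<and> A j k"
      using that far_coord_iff[OF assms(1), of j k N A] spec[OF *, of b] by (simp add: a_def)
    moreover have "\<bar>near_coord A b (j mod b) j - near_coord A b (j mod b) k\<bar> \<le> 1"
      using spec[OF *, of "j mod b"] assms(1) by (simp add: a_def less_SucI)
    ultimately show "A j k"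
      using near_coord_nonadj[of A j k b] that by fastforce
  qed
  then have "A j k \<longleftrightarrow> (\<forall>i<Suc b. \<bar>a j i - a k i\<bar> \<le> 1)" if "j \<noteq> k" "j < N" "k < N" for j k
    using that sym[of j k] sym[of k j]
    by (cases j k rule: linorder_cases) (auto simp: abs_minus_commute[of "a j _"])
  then show ?thesis
    by blast
qed

section \<open>From layouts to cubicity, and from digraphs to the abstract setting\<close>

lemma cubicity_le_layout:
  fixes f :: "'a \<Rightarrow> nat"
  assumes "graph G" "b > 0" "inj_on f (verts G)"
    and bandwidth: "\<And>u v. u \<rightarrow>\<^bsub>G\<^esub> v \<Longrightarrow> f v \<le> f u + b"
  shows "cubicity G \<le> Suc b"
proof -
  interpret graph G by fact
  \<comment> \<open>The graph transported to positions; unoccupied positions are isolated.\<close>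
  define A where "A j k \<longleftrightarrow> (\<exists>u v. u \<rightarrow>\<^bsub>G\<^esub> v \<and> f u = j \<and> f v = k)" for j k
  have A: "A (f u) (f v) \<longleftrightarrow> u \<rightarrow>\<^bsub>G\<^esub> v" if "u \<in> verts G" "v \<in> verts G" for u v
    using that assms(3) adj_in_verts unfolding A_def inj_on_def by blast
  obtain N where N: "\<And>v. v \<in> verts G \<Longrightarrow> f v < N"
    using finite_nat_set_iff_bounded[of "f ` verts G"] by auto
  have "A k j" if "A j k" for j k
    using that arcs_ends_symmetric[OF sym_arcs] unfolding A_def by blast
  moreover have "k \<le> j + b" if "A j k" for j k
    using that bandwidth by (auto simp: A_def)
  ultimately obtain a :: "nat \<Rightarrow> nat \<Rightarrow> real" where a:
    "\<forall>j<N. \<forall>k<N. j \<noteq> k \<longrightarrow> (A j k \<longleftrightarrow> (\<forall>i<Suc b. \<bar>a j i - a k i\<bar> \<le> 1))"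
    using ex_coordinates[OF \<open>b > 0\<close>, of A N] by blast
  have "u \<rightarrow>\<^bsub>G\<^esub> v \<longleftrightarrow> (\<forall>i<Suc b. \<bar>a (f u) i - a (f v) i\<bar> \<le> 1)"
    if "u \<in> verts G" "v \<in> verts G" "u \<noteq> v" for u v
    using a N A that assms(3) by (metis inj_onD)
  then have "cube_representation G (Suc b)
      (\<lambda>v. \<Pi>\<^sub>E i\<in>{..<Suc b}. {a (f v) i..a (f v) i + 1})"
    unfolding cube_representation_def is_cube_def cube_Int_nonempty_iff by blast
  then show ?thesis
    unfolding cubicity_def by (blast intro: Least_le)
qed

text \<open>Without parallel arcs, \<open>head G\<close> is injective on the arcs leaving
  \<open>v\<close>.\<close>

lemma out_degree_eq_card:
  assumes "graph G"
  shows "out_degree G v = card {w. v \<rightarrow>\<^bsub>G\<^esub> w}"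
proof -
  interpret graph G by fact
  have "inj_on (head G) (out_arcs G v)"
    by (rule inj_onI) (auto simp: arc_to_ends_def intro: no_multi_arcs)
  moreover have "head G ` out_arcs G v = {w. v \<rightarrow>\<^bsub>G\<^esub> w}"
    by (auto simp: arcs_ends_conv)
  ultimately show ?thesis
    unfolding out_degree_def by (metis card_image)
qed

text \<open>A walk is built first; shortening it to a path adds no vertices.\<close>

lemma (in simple_graph) joined_imp_vpath:
  assumes "joined A u v" "A \<subseteq> verts G" "\<And>a b. a \<sim> b \<Longrightarrow> a \<rightarrow>\<^bsub>G\<^esub> b"
  shows "\<exists>p. vpath p G \<and> hd p = u \<and> last p = v \<and> set p \<subseteq> A"
proof -
  have "\<exists>p. vwalk p G \<and> hd p = u \<and> last p = v \<and> set p \<subseteq> A"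
    using assms(1)
  proof (induction rule: joined.induct)
    case (refl u)
    then show ?case
      using assms(2) by (intro exI[of _ "[u]"]) (auto simp: vwalk_def)
  next
    case (step u w v)
    then obtain p where p: "vwalk p G" "hd p = w" "last p = v" "set p \<subseteq> A"
      by blast
    then obtain q where "p = w # q"
      by (cases p) (auto simp: vwalk_def)
    with p step show ?case
      using assms(2,3) by (intro exI[of _ "u # p"]) (auto simp: vwalk_def)
  qed
  then obtain p where p: "vwalk p G" "hd p = u" "last p = v" "set p \<subseteq> A"
    by blast
  then show ?thesis
    by (intro exI[of _ "vwalk_to_vpath p"])
      (auto simp: vwalk_to_vpath_hd vwalk_to_vpath_last
        intro: vwalk_to_vpath_vpath dest: vwalk_to_vpath_subset)
qed

lemma at_free_graph_if_at_free:
  assumes "graph G" "at_free G"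
  shows "at_free_graph (verts G) (dominates G)"
proof -
  interpret graph G by fact
  interpret simple_graph "verts G" "dominates G"
    using arcs_ends_symmetric[OF sym_arcs] adj_in_verts adj_not_same by unfold_locales auto
  show ?thesis
  proof
    fix a b c
    assume V: "a \<in> verts G" "b \<in> verts G" "c \<in> verts G"
      and j: "joined (far c) a b" "joined (far a) b c" "joined (far b) a c"
    have path: "\<exists>p. vpath p G \<and> hd p = u \<and> last p = v \<and> (\<forall>z\<in>set p. z \<noteq> w \<and> \<not> w \<rightarrow>\<^bsub>G\<^esub> z)"
      if uv: "joined (far w) u v" for u v w
    proof -
      have "far w \<subseteq> verts G"
        by (auto simp: far_def)
      then obtain p where "vpath p G" "hd p = u" "last p = v" "set p \<subseteq> far w"
        using joined_imp_vpath[OF uv] by blast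
      then show ?thesis
        by (auto simp: far_def)
    qed
    have "a \<in> far c" "b \<in> far c" "a \<in> far b"
      using joined_in j by blast+
    then have "distinct [a, b, c]" "\<not> a \<rightarrow>\<^bsub>G\<^esub> b" "\<not> b \<rightarrow>\<^bsub>G\<^esub> c" "\<not> a \<rightarrow>\<^bsub>G\<^esub> c"
      using adj_sym by (auto simp: far_def)
    then have "asteroidal_triple G a b c"
      unfolding asteroidal_triple_def using V path[OF j(1)] path[OF j(2)] path[OF j(3)]
      by simp
    then show False
      using assms(2) by (auto simp: at_free_def)
  qed
qed

text \<open>An arc forces positive maximum degree, so the bandwidth
  \<open>3 * max_degree G - 2\<close> is positive. For a graph with vertices but no arcs the bound
  would be \<open>-1\<close>.\<close>

theorem corollary3:
  fixes G :: "('a, 'b) pre_digraph"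
  assumes "graph G"
    and "arcs G \<noteq> {}"
    and "at_free G"
  shows "int (cubicity G) \<le> 3 * int (max_degree G) - 1"
proof -
  interpret graph G by fact
  interpret at_free_graph "verts G" "dominates G"
    using assms by (intro at_free_graph_if_at_free)
  have deg: "card {w. v \<rightarrow>\<^bsub>G\<^esub> w} \<le> max_degree G" if "v \<in> verts G" for v
    using that unfolding max_degree_def out_degree_eq_card[OF assms(1), symmetric] by simp
  obtain e where "e \<in> arcs G"
    using assms(2) by blast
  then have "head G e \<in> {w. tail G e \<rightarrow>\<^bsub>G\<^esub> w}" "tail G e \<in> verts G"
    by (auto simp: arcs_ends_conv)
  moreover have "finite {w. tail G e \<rightarrow>\<^bsub>G\<^esub> w}"
    by (rule finite_neighbours)
  ultimately have "0 < card {w. tail G e \<rightarrow>\<^bsub>G\<^esub> w}"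
    by (auto simp: card_gt_0_iff)
  also have "\<dots> \<le> max_degree G"
    by (rule deg) fact
  finally have pos: "max_degree G > 0" .
  have "\<exists>f :: 'a \<Rightarrow> nat. inj_on f (verts G) \<and>
      (\<forall>u\<in>verts G. \<forall>v\<in>verts G. u \<rightarrow>\<^bsub>G\<^esub> v \<longrightarrow> f v \<le> f u + (3 * max_degree G - 2))"
    by (rule ex_layout[OF deg pos subset_refl adj_V2])
  then obtain f :: "'a \<Rightarrow> nat" where inj: "inj_on f (verts G)"
    and bw: "\<forall>u\<in>verts G. \<forall>v\<in>verts G. u \<rightarrow>\<^bsub>G\<^esub> v \<longrightarrow> f v \<le> f u + (3 * max_degree G - 2)"
    by blast
  have "f v \<le> f u + (3 * max_degree G - 2)" if "u \<rightarrow>\<^bsub>G\<^esub> v" for u v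
    using bw adj_V[OF that] adj_V2[OF that] that by blast
  moreover have "3 * max_degree G - 2 > 0"
    using pos by simp
  ultimately have "cubicity G \<le> Suc (3 * max_degree G - 2)"
    using cubicity_le_layout[OF assms(1) _ inj] by blast
  then show ?thesis
    using pos by linarith
qed

end
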